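(* Let $n\ge 2$ and let $A:\mathbb{R}^2\to\mathbb{R}^{n\times n}$ be a real symmetric matrix valued function which is twice continuously differentiable in each entry, and suppose that $\alpha\in\mathbb{R}^2$ is a non-degenerate conical point of $A$ between $\lambda_1$ and $\lambda_2$. For $\mathbf{r}_i\in\mathbb{R}^2$ let $\lambda_{1,2}=\lambda_{1,2}(\mathbf{r}_i)$ be the two lowest eigenvalues of $A(\mathbf{r}_i)$ and let $v_{1,2}=v_{1,2}(\mathbf{r}_i)$ be corresponding (orthonormal, real) eigenvectors of $A(\mathbf{r}_i)$. Define $$\mathbf{r}_{i+1}=\mathbf{r}_i-\begin{pmatrix}\langle v_1,\frac{\partial A}{\partial x}v_1\rangle-\langle v_2,\frac{\partial A}{\partial x}v_2\rangle & \langle v_1,\frac{\partial A}{\partial y}v_1\rangle-\langle v_2,\frac{\partial A}{\partial y}v_2\rangle\\ 2\langle v_1,\frac{\partial A}{\partial x}v_2\rangle & 2\langle v_1,\frac{\partial A}{\partial y}v_2\rangle\end{pmatrix}^{-1}\begin{pmatrix}\lambda_1-\lambda_2\\0\end{pmatrix},$$ where the derivatives of $A$ are evaluated at $\mathbf{r}_i$. Then there exist an open neighborhood $\Omega\subset\mathbb{R}^2$ of $\alpha$ and a constant $C>0$ such that for all $\mathbf{r}_i\in\Omega$ the point $\mathbf{r}_{i+1}$ is well defined (the matrix above is invertible) and $$|\mathbf{r}_{i+1}-\alpha|\le C\,|\mathbf{r}_i-\alpha|^2 .$$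
   Context: Points of $\mathbb{R}^2$ are written $\mathbf{r}=(x,y)$. Eigenvalues of $A(\mathbf{r})$ are numbered in increasing order with multiplicity, $\lambda_1(\mathbf{r})\le\lambda_2(\mathbf{r})\le\cdots\le\lambda_n(\mathbf{r})$. The eigenvectors $v_1,v_2$ are any orthonormal pair with $A(\mathbf{r}_i)v_j=\lambda_jv_j$. Non-degenerate conical point: let $\alpha$ be a point where $A(\alpha)$ has a double eigenvalue $\lambda_1(\alpha)=\lambda_2(\alpha)$ (with $\lambda_2(\alpha)<\lambda_3(\alpha)$ if $n\ge3$). In some open neighborhood $\Omega_0$ of $\alpha$ there is a $C^2$ function $M$ with values in orthogonal $n\times n$ real matrices such that $M(\mathbf{r})^TA(\mathbf{r})M(\mathbf{r})=B(\mathbf{r})\oplus\Lambda(\mathbf{r})$, where $B\in C^2(\Omega_0,\mathbb{R}^{2\times2})$ is symmetric with eigenvalues $\lambda_1(\mathbf{r}),\lambda_2(\mathbf{r})$ and $\Lambda\in C^2(\Omega_0,\mathbb{R}^{(n-2)\times(n-2)})$. Put $\mathrm{disc}(B):=(\lambda_1-\lambda_2)^2=(B_{11}-B_{22})^2+4B_{12}^2$, a $C^2$ function of $\mathbf{r}$ attaining its minimum value $0$ at $\alpha$. The point $\alpha$ is called a non-degenerate conical point (between $\lambda_1$ and $\lambda_2$) if $\mathrm{disc}(B(\mathbf{r}))$ has a non-degenerate critical point at $\mathbf{r}=\alpha$ (i.e. its Hessian there is invertible). *)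

theory Defs
  imports "HOL-Analysis.Analysis" "HOL-Library.Multiset"
begin

section \<open>Eigenvalues in increasing order with multiplicity\<close>

definition eigenspace :: "real^'n^'n \<Rightarrow> real \<Rightarrow> (real^'n) set" where
  "eigenspace A t = {v. A *v v = t *\<^sub>R v}"

definition spectrum :: "real^'n^'n \<Rightarrow> real set" where
  "spectrum A = {t. \<exists>v. v \<noteq> 0 \<and> v \<in> eigenspace A t}"

text \<open>Multiplicities are dimensions of eigenspaces. The matrices below are all real symmetric,
  so these are also the multiplicities as roots of the characteristic polynomial.\<close>

definition eigenvalues :: "real^'n^'n \<Rightarrow> real list" where
  "eigenvalues A =
     sorted_list_of_multiset (\<Sum>t\<in>spectrum A. replicate_mset (dim (eigenspace A t)) t)"

text \<open>Numbering starts at 1; \<open>nth_eigenvalue k A\<close> is meaningful for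
  symmetric \<open>A\<close> and \<open>1 \<le> k \<le> CARD('n)\<close>.\<close>

definition nth_eigenvalue :: "nat \<Rightarrow> real^'n^'n \<Rightarrow> real" where
  "nth_eigenvalue k A = eigenvalues A ! (k - 1)"


section \<open>Differentiability in the plane\<close>

definition C2_on :: "('a::real_normed_vector) set \<Rightarrow> ('a \<Rightarrow> 'b::real_normed_vector) \<Rightarrow> bool" where
  "C2_on S f \<longleftrightarrow>
     (\<exists>(f' :: 'a \<Rightarrow> 'a \<Rightarrow>\<^sub>L 'b) (f'' :: 'a \<Rightarrow> 'a \<Rightarrow>\<^sub>L ('a \<Rightarrow>\<^sub>L 'b)).
        (\<forall>r\<in>S. (f has_derivative blinfun_apply (f' r)) (at r)) \<and>
        (\<forall>r\<in>S. (f' has_derivative blinfun_apply (f'' r)) (at r)) \<and>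
        continuous_on S f'')"

definition C2_entries_on :: "(real^2) set \<Rightarrow> (real^2 \<Rightarrow> real^'m^'n) \<Rightarrow> bool" where
  "C2_entries_on S A \<longleftrightarrow> (\<forall>i j. C2_on S (\<lambda>r. A r $ i $ j))"

definition partial_deriv :: "2 \<Rightarrow> (real^2 \<Rightarrow> 'b::real_normed_vector) \<Rightarrow> real^2 \<Rightarrow> 'b" where
  "partial_deriv k f r = vector_derivative (\<lambda>t. f (r + t *\<^sub>R axis k 1)) (at 0)"

definition hessian :: "(real^2 \<Rightarrow> real) \<Rightarrow> real^2 \<Rightarrow> real^2^2" where
  "hessian f r = (\<chi> i j. partial_deriv i (partial_deriv j f) r)"

definition nondegenerate_critical_point :: "(real^2 \<Rightarrow> real) \<Rightarrow> real^2 \<Rightarrow> bool" where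
  "nondegenerate_critical_point f r \<longleftrightarrow>
     (\<forall>k. partial_deriv k f r = 0) \<and> invertible (hessian f r)"


section \<open>Non-degenerate conical points\<close>

text \<open>\<open>D = B \<oplus> L\<close>, with the index set of \<open>B\<close> embedded in \<open>'n\<close> by the injection \<open>p\<close>:
  since \<open>'n\<close> carries no order, \<open>p 1\<close> and \<open>p 2\<close> play the role of the first two indices.
  The other summand, of size \<open>CARD('n) - 2\<close>, consists of the entries of \<open>L\<close> whose indices both
  lie outside \<open>range p\<close>; the remaining entries of \<open>L\<close> are irrelevant.\<close>

definition is_direct_sum ::
    "(2 \<Rightarrow> 'n) \<Rightarrow> real^'n^'n \<Rightarrow> real^2^2 \<Rightarrow> real^'n^'n \<Rightarrow> bool" where
  "is_direct_sum p D B L \<longleftrightarrow>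
     (\<forall>a b. D $ p a $ p b = B $ a $ b) \<and>
     (\<forall>i j. i \<notin> range p \<longrightarrow> j \<notin> range p \<longrightarrow> D $ i $ j = L $ i $ j) \<and>
     (\<forall>a j. j \<notin> range p \<longrightarrow> D $ p a $ j = 0 \<and> D $ j $ p a = 0)"

definition block_reduction ::
    "(real^2 \<Rightarrow> real^'n^'n) \<Rightarrow> (real^2) set \<Rightarrow> (real^2 \<Rightarrow> real^'n^'n) \<Rightarrow> (2 \<Rightarrow> 'n) \<Rightarrow>
     (real^2 \<Rightarrow> real^2^2) \<Rightarrow> (real^2 \<Rightarrow> real^'n^'n) \<Rightarrow> bool" where
  "block_reduction A \<Omega>0 M p B L \<longleftrightarrow>
     inj p \<and> C2_entries_on \<Omega>0 M \<and> C2_entries_on \<Omega>0 B \<and> C2_entries_on \<Omega>0 L \<and>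
     (\<forall>r\<in>\<Omega>0.
        orthogonal_matrix (M r) \<and>
        is_direct_sum p (transpose (M r) ** A r ** M r) (B r) (L r) \<and>
        transpose (B r) = B r \<and>
        nth_eigenvalue 1 (B r) = nth_eigenvalue 1 (A r) \<and>
        nth_eigenvalue 2 (B r) = nth_eigenvalue 2 (A r))"

definition disc :: "real^2^2 \<Rightarrow> real" where
  "disc B = (nth_eigenvalue 1 B - nth_eigenvalue 2 B)\<^sup>2"

text \<open>Near a point with \<open>\<lambda>\<^sub>1 = \<lambda>\<^sub>2 < \<lambda>\<^sub>3\<close>, a block reduction of a symmetric \<open>C\<^sup>2\<close> function always
  exists, and \<open>disc (B r)\<close> does not depend on its choice.\<close>

definition nondegenerate_conical_point :: "(real^2 \<Rightarrow> real^'n^'n) \<Rightarrow> real^2 \<Rightarrow> bool" where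
  "nondegenerate_conical_point A \<alpha> \<longleftrightarrow>
     nth_eigenvalue 1 (A \<alpha>) = nth_eigenvalue 2 (A \<alpha>) \<and>
     (CARD('n) \<ge> 3 \<longrightarrow> nth_eigenvalue 2 (A \<alpha>) < nth_eigenvalue 3 (A \<alpha>)) \<and>
     (\<exists>\<Omega>0 M p B L. open \<Omega>0 \<and> \<alpha> \<in> \<Omega>0 \<and> block_reduction A \<Omega>0 M p B L \<and>
        nondegenerate_critical_point (\<lambda>r. disc (B r)) \<alpha>)"


section \<open>The iteration\<close>

definition step_matrix :: "(real^2 \<Rightarrow> real^'n^'n) \<Rightarrow> real^2 \<Rightarrow> real^'n \<Rightarrow> real^'n \<Rightarrow> real^2^2" where
  "step_matrix A r v1 v2 =
     (let Ax = partial_deriv 1 A r; Ay = partial_deriv 2 A r in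
      vector [vector [v1 \<bullet> (Ax *v v1) - v2 \<bullet> (Ax *v v2), v1 \<bullet> (Ay *v v1) - v2 \<bullet> (Ay *v v2)],
              vector [2 * (v1 \<bullet> (Ax *v v2)), 2 * (v1 \<bullet> (Ay *v v2))]])"

definition next_iterate :: "(real^2 \<Rightarrow> real^'n^'n) \<Rightarrow> real^2 \<Rightarrow> real^'n \<Rightarrow> real^'n \<Rightarrow> real^2" where
  "next_iterate A r v1 v2 =
     r - matrix_inv (step_matrix A r v1 v2)
           *v vector [nth_eigenvalue 1 (A r) - nth_eigenvalue 2 (A r), 0]"

definition lowest_eigenpair :: "real^'n^'n \<Rightarrow> real^'n \<Rightarrow> real^'n \<Rightarrow> bool" where
  "lowest_eigenpair A v1 v2 \<longleftrightarrow>
     norm v1 = 1 \<and> norm v2 = 1 \<and> v1 \<bullet> v2 = 0 \<and>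
     A *v v1 = nth_eigenvalue 1 A *\<^sub>R v1 \<and> A *v v2 = nth_eigenvalue 2 A *\<^sub>R v2"

end

theory Submission
  imports Defs
begin

text \<open>
  Near the conical point the two lowest eigenvalues and eigenvectors of \<open>A\<close> are those of the
  \<open>2 \<times> 2\<close> block \<open>B\<close>. A symmetric \<open>2 \<times> 2\<close> matrix \<open>X\<close> is scalar iff its coordinate gap
  \<open>g X = (X\<^sub>1\<^sub>1 - X\<^sub>2\<^sub>2, 2 X\<^sub>1\<^sub>2)\<close> vanishes, and the discriminant is \<open>\<bar>g X\<bar>\<^sup>2\<close>. So the conical point
  is a zero of \<open>F = g \<circ> B\<close>. The Hessian of \<open>\<bar>F\<bar>\<^sup>2\<close> at a zero of \<open>F\<close> is \<open>2 (DF)\<^sup>T DF\<close>, so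
  non-degeneracy says exactly that this zero is simple: \<open>DF(\<alpha>)\<close> is injective
  (\<open>hessian_norm_square_invertible_imp_injective\<close>).

  The iteration is Newton's method for \<open>F\<close>, up to two changes that do not affect the order.

  \<^item> It works in the eigenbasis \<open>w\<^sub>1, w\<^sub>2\<close> of \<open>B(r)\<close> instead of the coordinate basis. Changing the
    orthonormal basis acts on \<open>g X\<close> by a rotation or reflection through twice the angle, hence
    preserves its length (\<open>norm_gap_vector_orthonormal\<close>). All estimates can
    therefore be made one point at a time and uniformly in the eigenvectors, which have no limit
    at \<open>\<alpha>\<close>.
  \<^item> It uses the derivative of \<open>A\<close> instead of that of \<open>B\<close>. With \<open>v\<^sub>i = M u\<^sub>i\<close>, differentiating
    \<open>(M u\<^sub>i) \<bullet> A (M u\<^sub>j) = w\<^sub>i \<bullet> B w\<^sub>j\<close> shows that \<open>v\<^sub>i \<bullet> A' v\<^sub>j\<close> and \<open>w\<^sub>i \<bullet> B' w\<^sub>j\<close> differ by a multiple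
    of \<open>\<lambda>\<^sub>i - \<lambda>\<^sub>j\<close> (\<open>inner_derivative_moving_frame\<close>). This is zero for \<open>i = j\<close> and
    \<open>O(\<bar>r - \<alpha>\<bar>)\<close> for \<open>i \<noteq> j\<close>.

  Let \<open>S\<close> be the step matrix at \<open>r\<close> and \<open>r'\<close> the next iterate. Both changes together give
  \<open>\<bar>S x\<bar> \<ge> (c - O(\<bar>r - \<alpha>\<bar>)) \<bar>x\<bar>\<close>, and \<open>S (r' - \<alpha>) = S (r - \<alpha>) - (\<lambda>\<^sub>1 - \<lambda>\<^sub>2, 0)\<close> is, up to an orthogonal
  map, the Taylor remainder of \<open>F\<close> plus a term of size \<open>O(\<bar>r - \<alpha>\<bar>\<^sup>2)\<close>
  (\<open>perturbed_coordinate_gap_estimates\<close>). The quadratic bound follows by dividing.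
\<close>

section \<open>The numbering of eigenvalues of symmetric matrices\<close>

lemma symmetric_entry:
  assumes "transpose B = B"
  shows "B$i$j = B$j$i"
  using arg_cong[OF assms, of "\<lambda>X. X$i$j"] by (simp add: transpose_def)

lemma subspace_eigenspace: "subspace (eigenspace A t)"
  by (auto simp: subspace_def eigenspace_def matrix_vector_right_distrib
      scaleR_right_distrib matrix_vector_mult_scaleR)

lemma eigenvectors_orthogonal:
  fixes A :: "real^'n^'n"
  assumes "transpose A = A" "A *v v = s *\<^sub>R v" "A *v w = t *\<^sub>R w" "s \<noteq> t"
  shows "v \<bullet> w = 0"
proof -
  have "s * (v \<bullet> w) = (A *v v) \<bullet> w" using assms by simp
  also have "\<dots> = v \<bullet> (A *v w)"
    by (metis assms(1) dot_lmul_matrix vector_transpose_matrix)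
  also have "\<dots> = t * (v \<bullet> w)" using assms by simp
  finally show ?thesis using assms by simp
qed

text \<open>Choosing one eigenvector for each eigenvalue gives an orthogonal, hence independent, family.
  Finiteness is what makes the sum defining \<open>eigenvalues\<close> meaningful.\<close>

lemma finite_spectrum_symmetric:
  fixes A :: "real^'n^'n"
  assumes "transpose A = A"
  shows "finite (spectrum A)"
proof -
  obtain e where e: "\<And>t. t \<in> spectrum A \<Longrightarrow> e t \<noteq> 0 \<and> A *v e t = t *\<^sub>R e t"
  proof -
    have "\<forall>t. \<exists>v. t \<in> spectrum A \<longrightarrow> v \<noteq> 0 \<and> A *v v = t *\<^sub>R v"
      by (auto simp: spectrum_def eigenspace_def)
    then show ?thesis using that by metis
  qed
  have orth: "e s \<bullet> e t = 0" if "s \<in> spectrum A" "t \<in> spectrum A" "s \<noteq> t" for s t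
    using eigenvectors_orthogonal[OF assms, of "e s" s "e t" t] e that by blast
  have inj: "inj_on e (spectrum A)"
    using orth e by (metis inj_onI inner_eq_zero_iff)
  have "pairwise orthogonal (e ` spectrum A)"
    using orth by (auto simp: pairwise_def orthogonal_def)
  moreover have "0 \<notin> e ` spectrum A" using e by force
  ultimately have "independent (e ` spectrum A)"
    by (rule pairwise_orthogonal_independent)
  then have "finite (e ` spectrum A)" by (rule independent_imp_finite)
  then show ?thesis using inj by (rule finite_imageD)
qed

lemma count_eigenvalues:
  assumes "finite (spectrum A)"
  shows "count (mset (eigenvalues A)) t = dim (eigenspace A t)"
proof -
  have "count (mset (eigenvalues A)) t
      = (\<Sum>s\<in>spectrum A. if s = t then dim (eigenspace A s) else 0)"
    by (simp add: eigenvalues_def count_sum, rule sum.cong) auto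
  also have "\<dots> = (if t \<in> spectrum A then dim (eigenspace A t) else 0)"
    using assms by simp
  also have "\<dots> = dim (eigenspace A t)"
  proof (cases "t \<in> spectrum A")
    case False
    then have "eigenspace A t \<subseteq> {0}" by (auto simp: spectrum_def)
    then show ?thesis using False by simp
  qed simp
  finally show ?thesis .
qed

text \<open>A sorted list that starts with \<open>t\<close> and contains it three times starts with three copies
  of \<open>t\<close>. The strict gap \<open>\<lambda>\<^sub>2 < \<lambda>\<^sub>3\<close> thus bounds the dimension of the lowest eigenspace by two.\<close>

lemma nth_eigenvalue_3_eq_1:
  fixes A :: "real^'n^'n"
  assumes "transpose A = A" "3 \<le> dim (eigenspace A (nth_eigenvalue 1 A))"
  shows "nth_eigenvalue 3 A = nth_eigenvalue 1 A"
proof -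
  define t where "t = nth_eigenvalue 1 A"
  have c: "3 \<le> count (mset (eigenvalues A)) t"
    using count_eigenvalues[OF finite_spectrum_symmetric[OF assms(1)], of t] assms(2)
    unfolding t_def by linarith
  have "3 \<le> length (eigenvalues A)"
    using c count_le_length[of "eigenvalues A" t] by (simp add: count_mset)
  then obtain a b x ys where xs: "eigenvalues A = a # b # x # ys"
    by (auto simp: numeral_eq_Suc Suc_le_length_iff)
  have srt: "sorted (eigenvalues A)" by (simp add: eigenvalues_def)
  have a: "a = t" by (simp add: t_def nth_eigenvalue_def xs)
  have "x = t"
  proof (rule ccontr)
    assume "x \<noteq> t"
    then have "t \<notin> set ys"
      using srt a xs by auto
    then have ys: "count (mset ys) t = 0" by (simp add: count_eq_zero_iff)
    have "count (mset (eigenvalues A)) t \<le> 2" by (simp add: xs ys \<open>x \<noteq> t\<close>)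
    then show False using c by simp
  qed
  then show ?thesis by (simp add: nth_eigenvalue_def xs t_def)
qed

lemma eigenspace_2_iff:
  fixes B :: "real^2^2"
  shows "v \<in> eigenspace B t \<longleftrightarrow>
    B$1$1 * v$1 + B$1$2 * v$2 = t * v$1 \<and> B$2$1 * v$1 + B$2$2 * v$2 = t * v$2"
  by (simp add: eigenspace_def vec_eq_iff forall_2 matrix_vector_mult_def sum_2)

lemma spectrum_2_iff:
  fixes B :: "real^2^2"
  assumes "transpose B = B"
  shows "t \<in> spectrum B \<longleftrightarrow> (t - B$1$1) * (t - B$2$2) = (B$1$2)\<^sup>2"
proof -
  have "t \<in> spectrum B \<longleftrightarrow> (\<exists>v. v \<noteq> 0 \<and> (B - t *\<^sub>R mat 1) *v v = 0)"
    by (simp add: spectrum_def eigenspace_def matrix_vector_mult_diff_rdistrib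
        scaleR_matrix_vector_assoc[symmetric])
  also have "\<dots> \<longleftrightarrow> det (B - t *\<^sub>R mat 1) = 0"
    using invertible_det_nz[of "B - t *\<^sub>R mat 1"] matrix_left_invertible_ker[of "B - t *\<^sub>R mat 1"]
      matrix_left_right_inverse invertible_def by metis
  also have "\<dots> \<longleftrightarrow> (t - B$1$1) * (t - B$2$2) = (B$1$2)\<^sup>2"
  proof -
    have "B$2$1 = B$1$2" by (rule symmetric_entry[OF assms])
    then show ?thesis
      by (simp add: det_2 mat_def power2_eq_square algebra_simps)
  qed
  finally show ?thesis .
qed

lemma spectrum_2:
  fixes B :: "real^2^2"
  assumes sym: "transpose B = B"
  defines "q \<equiv> sqrt ((B$1$1 - B$2$2)\<^sup>2 + (2 * B$1$2)\<^sup>2)"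
  shows "spectrum B = {(B$1$1 + B$2$2 - q) / 2, (B$1$1 + B$2$2 + q) / 2}"
proof -
  define s t where "s = (B$1$1 + B$2$2 - q) / 2" and "t = (B$1$1 + B$2$2 + q) / 2"
  have q2: "q\<^sup>2 = (B$1$1 - B$2$2)\<^sup>2 + (2 * B$1$2)\<^sup>2" by (simp add: q_def)
  have "(x - B$1$1) * (x - B$2$2) = (B$1$2)\<^sup>2 \<longleftrightarrow> (x - s) * (x - t) = 0" for x
  proof -
    have "(x - s) * (x - t) = (x - (B$1$1 + B$2$2) / 2)\<^sup>2 - q\<^sup>2 / 4"
      by (simp add: s_def t_def power2_eq_square field_simps)
    also have "\<dots> = (x - B$1$1) * (x - B$2$2) - (B$1$2)\<^sup>2"
      unfolding q2 by (simp add: power2_eq_square field_simps)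
    finally show ?thesis by simp
  qed
  then show ?thesis unfolding s_def[symmetric] t_def[symmetric] using spectrum_2_iff[OF sym] by auto
qed

lemma eigenvalues_2:
  fixes B :: "real^2^2"
  assumes sym: "transpose B = B"
  defines "q \<equiv> sqrt ((B$1$1 - B$2$2)\<^sup>2 + (2 * B$1$2)\<^sup>2)"
  shows "eigenvalues B = [(B$1$1 + B$2$2 - q) / 2, (B$1$1 + B$2$2 + q) / 2]"
proof -
  define s t where "s = (B$1$1 + B$2$2 - q) / 2" and "t = (B$1$1 + B$2$2 + q) / 2"
  have q0: "0 \<le> q" and q2: "q\<^sup>2 = (B$1$1 - B$2$2)\<^sup>2 + (2 * B$1$2)\<^sup>2"
    by (simp_all add: q_def)
  have spec: "spectrum B = {s, t}"
    using spectrum_2[OF sym] by (simp add: s_def t_def q_def)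
  have B21: "B$2$1 = B$1$2" by (rule symmetric_entry[OF sym])
  show ?thesis
  proof (cases "q = 0")
    case True
    then have "(B$1$1 - B$2$2)\<^sup>2 + (2 * B$1$2)\<^sup>2 = 0" using q2 by simp
    then have *: "B$1$1 = B$2$2 \<and> B$1$2 = 0"
      by (simp add: sum_power2_eq_zero_iff add_nonneg_eq_0_iff)
    have "eigenspace B s = UNIV" using * B21 True by (auto simp: eigenspace_2_iff s_def)
    then have "dim (eigenspace B s) = 2" by simp
    moreover have "s = t" using True by (simp add: s_def t_def)
    ultimately show ?thesis unfolding s_def[symmetric] t_def[symmetric]
      by (simp add: eigenvalues_def spec numeral_2_eq_2)
  next
    case False
    have d1: "dim (eigenspace B x) = 1" if "x \<in> {s, t}" for x
    proof -
      have "x \<in> spectrum B" using spec that by simp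
      then obtain v where v: "v \<noteq> 0" "v \<in> eigenspace B x" by (auto simp: spectrum_def)
      have "dim (eigenspace B x) \<noteq> 0" using v by auto
      \<comment> \<open>a two-dimensional eigenspace would make \<open>B\<close> scalar, hence \<open>q = 0\<close>\<close>
      moreover have "dim (eigenspace B x) \<noteq> 2"
      proof
        assume "dim (eigenspace B x) = 2"
        then have "span (eigenspace B x) = UNIV" by (simp add: dim_eq_full[symmetric])
        then have U: "eigenspace B x = UNIV"
          using span_eq_iff[of "eigenspace B x"] subspace_eigenspace by metis
        have "axis 1 1 \<in> eigenspace B x" "axis 2 1 \<in> eigenspace B x" by (simp_all add: U)
        then have "B$1$1 = B$2$2 \<and> B$1$2 = 0" by (auto simp: eigenspace_2_iff axis_def)
        then show False using False q2 by simp
      qed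
      moreover have "dim (eigenspace B x) \<le> 2"
        using dim_subset_UNIV[of "eigenspace B x"] by simp
      ultimately show ?thesis by linarith
    qed
    have "s < t" using False q0 by (simp add: s_def t_def)
    then show ?thesis unfolding s_def[symmetric] t_def[symmetric]
      using d1[of s] d1[of t] by (simp add: eigenvalues_def spec)
  qed
qed

lemma nth_eigenvalue_2_in_spectrum:
  fixes B :: "real^2^2"
  assumes "transpose B = B"
  shows "nth_eigenvalue 1 B \<in> spectrum B" "nth_eigenvalue 2 B \<in> spectrum B"
  by (simp_all add: nth_eigenvalue_def eigenvalues_2[OF assms] spectrum_2[OF assms])

lemma disc_eq:
  fixes B :: "real^2^2"
  assumes "transpose B = B"
  shows "disc B = (B$1$1 - B$2$2)\<^sup>2 + (2 * B$1$2)\<^sup>2"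
proof -
  define q where "q = sqrt ((B$1$1 - B$2$2)\<^sup>2 + (2 * B$1$2)\<^sup>2)"
  have "disc B = q\<^sup>2"
    unfolding disc_def nth_eigenvalue_def eigenvalues_2[OF assms] q_def[symmetric]
    by (simp add: power2_eq_square field_simps)
  then show ?thesis by (simp add: q_def)
qed

section \<open>Gap vectors\<close>

text \<open>The first component is the difference of the diagonal entries, the second twice the
  off-diagonal entry, of the matrix of \<open>X\<close> relative to the pair \<open>v, w\<close>. Being linear in \<open>X\<close>, it
  describes both the columns of the step matrix (\<open>X\<close> a derivative of \<open>A\<close>) and the right-hand side
  of the iteration (\<open>X = A\<close>).\<close>

definition gap_vector :: "real^'n \<Rightarrow> real^'n \<Rightarrow> real^'n^'n \<Rightarrow> real^2" where
  "gap_vector v w X = vector [v \<bullet> (X *v v) - w \<bullet> (X *v w), 2 * (v \<bullet> (X *v w))]"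

definition coordinate_gap :: "real^2^2 \<Rightarrow> real^2" where
  "coordinate_gap = gap_vector (axis 1 1) (axis 2 1)"

lemma linear_gap_vector: "linear (gap_vector v w)"
  by (rule linearI)
    (simp_all add: gap_vector_def vec_eq_iff forall_2 matrix_vector_mult_add_rdistrib
      inner_add_right scaleR_matrix_vector_assoc[symmetric] algebra_simps)

lemma coordinate_gap_eq: "coordinate_gap X = vector [X$1$1 - X$2$2, 2 * X$1$2]"
  by (simp add: coordinate_gap_def gap_vector_def inner_axis' matrix_vector_mult_basis column_def)

lemma linear_coordinate_gap: "linear coordinate_gap"
  by (simp add: coordinate_gap_def linear_gap_vector)

lemma norm_vector_2: "norm (vector [a, b] :: real^2) = sqrt (a\<^sup>2 + b\<^sup>2)"
  by (simp add: norm_vec_def L2_set_def sum_2)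

text \<open>If \<open>v = (cos \<theta>, sin \<theta>)\<close>, then \<open>w = \<plusminus>(- sin \<theta>, cos \<theta>)\<close>, and the gap vector relative to
  \<open>v, w\<close> is the coordinate gap rotated by \<open>2\<theta>\<close>, possibly followed by a reflection.\<close>

lemma norm_gap_vector_orthonormal:
  fixes X :: "real^2^2"
  assumes sym: "transpose X = X" and v: "norm v = 1" and w: "norm w = 1" and vw: "v \<bullet> w = 0"
  shows "norm (gap_vector v w X) = norm (coordinate_gap X)"
proof -
  define a b c d where "a = v$1" and "b = v$2" and "c = w$1" and "d = w$2"
  have ab: "a\<^sup>2 + b\<^sup>2 = 1" using v by (simp add: a_def b_def norm_vec_def L2_set_def sum_2)
  have cd: "c\<^sup>2 + d\<^sup>2 = 1" using w by (simp add: c_def d_def norm_vec_def L2_set_def sum_2)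
  have orth: "a * c + b * d = 0"
    using vw by (simp add: a_def b_def c_def d_def inner_vec_def sum_2)
  \<comment> \<open>\<open>\<sigma> = \<plusminus>1\<close> is the orientation of the basis\<close>
  define \<sigma> where "\<sigma> = a * d - b * c"
  have c: "c = - \<sigma> * b"
  proof -
    have "- \<sigma> * b = - a * (b * d) + b\<^sup>2 * c"
      by (simp add: \<sigma>_def power2_eq_square algebra_simps)
    also have "\<dots> = (a\<^sup>2 + b\<^sup>2) * c"
      using orth by (simp add: eq_neg_iff_add_eq_0[symmetric] power2_eq_square algebra_simps)
    finally show ?thesis using ab by simp
  qed
  have d: "d = \<sigma> * a"
  proof -
    have "\<sigma> * a = a\<^sup>2 * d - b * (a * c)"
      by (simp add: \<sigma>_def power2_eq_square algebra_simps)
    also have "a * c = - (b * d)" using orth by simp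
    finally have "\<sigma> * a = (a\<^sup>2 + b\<^sup>2) * d" by (simp add: power2_eq_square algebra_simps)
    then show ?thesis using ab by simp
  qed
  have \<sigma>2: "\<sigma>\<^sup>2 = 1"
  proof -
    have "\<sigma>\<^sup>2 * (a\<^sup>2 + b\<^sup>2) = 1" using cd by (simp add: c d power_mult_distrib algebra_simps)
    then show ?thesis using ab by simp
  qed
  define P Q where "P = X$1$1 - X$2$2" and "Q = 2 * X$1$2"
  have X21: "X$2$1 = X$1$2" by (rule symmetric_entry[OF sym])
  have q: "x \<bullet> (X *v y) = X$1$1 * (x$1 * y$1) + X$1$2 * (x$1 * y$2 + x$2 * y$1) + X$2$2 * (x$2 * y$2)"
    for x y :: "real^2"
    by (simp add: inner_vec_def matrix_vector_mult_def sum_2 X21 algebra_simps)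
  have 1: "v \<bullet> (X *v v) - w \<bullet> (X *v w) = (a\<^sup>2 - b\<^sup>2) * P + 2 * a * b * Q"
  proof -
    have "w \<bullet> (X *v w) = \<sigma>\<^sup>2 * (X$1$1 * b\<^sup>2 - 2 * X$1$2 * a * b + X$2$2 * a\<^sup>2)"
      unfolding q c_def[symmetric] d_def[symmetric] c d by (simp add: power2_eq_square algebra_simps)
    then show ?thesis
      unfolding \<sigma>2 q a_def[symmetric] b_def[symmetric] P_def Q_def
      by (simp add: power2_eq_square algebra_simps)
  qed
  have 2: "2 * (v \<bullet> (X *v w)) = \<sigma> * ((a\<^sup>2 - b\<^sup>2) * Q - 2 * a * b * P)"
    unfolding q a_def[symmetric] b_def[symmetric] c_def[symmetric] d_def[symmetric] c d P_def Q_def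
    by (simp add: power2_eq_square algebra_simps)
  have "(v \<bullet> (X *v v) - w \<bullet> (X *v w))\<^sup>2 + (2 * (v \<bullet> (X *v w)))\<^sup>2
      = ((a\<^sup>2 - b\<^sup>2) * P + 2 * a * b * Q)\<^sup>2 + \<sigma>\<^sup>2 * ((a\<^sup>2 - b\<^sup>2) * Q - 2 * a * b * P)\<^sup>2"
    unfolding 1 2 by (simp add: power_mult_distrib)
  also have "\<dots> = (a\<^sup>2 + b\<^sup>2)\<^sup>2 * (P\<^sup>2 + Q\<^sup>2)"
    unfolding \<sigma>2 by (simp add: power2_eq_square algebra_simps)
  also have "\<dots> = P\<^sup>2 + Q\<^sup>2" by (simp add: ab)
  finally show ?thesis
    by (simp add: gap_vector_def coordinate_gap_eq norm_vector_2 P_def Q_def)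
qed

lemma equal_eigenvalues_2_scalar:
  fixes B :: "real^2^2"
  assumes sym: "transpose B = B" and t: "nth_eigenvalue 1 B = t" "nth_eigenvalue 2 B = t"
  shows "B *v w = t *\<^sub>R w" "coordinate_gap B = 0"
proof -
  have "(B$1$1 - B$2$2)\<^sup>2 + (2 * B$1$2)\<^sup>2 = 0"
    using disc_eq[OF sym] t by (simp add: disc_def)
  then have *: "B$1$1 = B$2$2" "B$1$2 = 0" unfolding sum_power2_eq_zero_iff by simp_all
  have "(t - B$1$1) * (t - B$2$2) = (B$1$2)\<^sup>2"
    using nth_eigenvalue_2_in_spectrum(1)[OF sym] t by (simp add: spectrum_2_iff[OF sym])
  then have "t = B$1$1" using * by simp
  then show "B *v w = t *\<^sub>R w" "coordinate_gap B = 0"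
    using * symmetric_entry[OF sym, of 2 1] eigenspace_2_iff[of w B t]
    by (simp_all add: eigenspace_def coordinate_gap_eq vec_eq_iff forall_2)
qed

lemma gap_vector_eigenpair:
  assumes "norm v = 1" "norm w = 1" "v \<bullet> w = 0" "X *v v = s *\<^sub>R v" "X *v w = t *\<^sub>R w"
  shows "gap_vector v w X = vector [s - t, 0]"
  using assms by (simp add: gap_vector_def dot_square_norm)

section \<open>Consequences of twice differentiability\<close>

lemma norm_matrix_vector_le:
  fixes X :: "real^'n^'m"
  shows "norm (X *v x) \<le> norm X * norm x"
proof -
  have "norm (X *v x) \<le> L2_set (\<lambda>k. norm (X$k) * norm x) UNIV"
    unfolding norm_vec_def[of "X *v x"]
    by (rule L2_set_mono) (auto simp: matrix_vector_mul_component Cauchy_Schwarz_ineq2)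
  also have "\<dots> = norm X * norm x"
    by (simp add: norm_vec_def[of X] L2_set_left_distrib)
  finally show ?thesis .
qed

lemma has_derivative_vec_nth:
  fixes f :: "'a::real_normed_vector \<Rightarrow> 'b::euclidean_space^'n"
  assumes "\<And>i. ((\<lambda>x. f x $ i) has_derivative (\<lambda>h. f' h $ i)) (at a)"
  shows "(f has_derivative f') (at a)"
  unfolding has_derivative_componentwise_within[of f f' a UNIV]
  by (auto simp: Basis_vec_def inner_axis intro!: has_derivative_inner_left assms)

lemma has_derivative_locally_lipschitz:
  assumes "(g has_derivative g') (at a)"
  obtains K where "0 \<le> K" "\<forall>\<^sub>F r in nhds a. norm (g r - g a) \<le> K * norm (r - a)"
proof -
  from assms have bl: "bounded_linear g'"
    and "\<forall>e>0. \<exists>d>0. \<forall>y. norm (y - a) < d \<longrightarrow> norm (g y - g a - g' (y - a)) \<le> e * norm (y - a)"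
    by (auto simp: has_derivative_at_alt)
  then obtain d where d: "d > 0"
    "\<And>y. norm (y - a) < d \<Longrightarrow> norm (g y - g a - g' (y - a)) \<le> 1 * norm (y - a)"
    by (metis zero_less_one)
  obtain L where L: "L > 0" "\<And>x. norm (g' x) \<le> norm x * L"
    using bounded_linear.pos_bounded[OF bl] by blast
  have "norm (g y - g a) \<le> (1 + L) * norm (y - a)" if "dist y a < d" for y
  proof -
    have "norm (g y - g a) \<le> norm (g y - g a - g' (y - a)) + norm (g' (y - a))"
      using norm_triangle_ineq[of "g y - g a - g' (y - a)" "g' (y - a)"] by simp
    then show ?thesis using d(2)[of y] L(2)[of "y - a"] that by (simp add: dist_norm algebra_simps)
  qed
  then have "\<forall>\<^sub>F y in nhds a. norm (g y - g a) \<le> (1 + L) * norm (y - a)"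
    using d(1) by (auto simp: eventually_nhds_metric)
  then show ?thesis using L(1) that[of "1 + L"] by simp
qed

text \<open>The mean value inequality for \<open>F - DF a\<close>, whose derivative at distance at most
  \<open>norm (r - a)\<close> from \<open>a\<close> is bounded by \<open>K * norm (r - a)\<close>. The second estimate, with the
  derivative taken at \<open>r\<close> instead of \<open>a\<close>, is the one behind Newton's method.\<close>

lemma first_order_estimates:
  fixes F :: "'a::real_normed_vector \<Rightarrow> 'b::real_normed_vector"
  assumes der: "\<And>s. s \<in> ball a e \<Longrightarrow> (F has_derivative DF s) (at s)"
    and lip: "\<And>s h. s \<in> ball a e \<Longrightarrow> norm (DF s h - DF a h) \<le> K * norm (s - a) * norm h"
    and K: "0 \<le> K" and r: "r \<in> ball a e"
  shows "norm (F r - F a - DF a (r - a)) \<le> K * (norm (r - a))\<^sup>2"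
    and "norm (DF r (r - a) - (F r - F a)) \<le> 2 * K * (norm (r - a))\<^sup>2"
proof -
  have a: "a \<in> ball a e" using r by (auto simp: dist_norm intro: le_less_trans[OF norm_ge_zero])
  note bl = has_derivative_bounded_linear[OF der[OF a]]
  let ?G = "\<lambda>s. F s - DF a s"
  have sub: "s \<in> ball a e" "norm (s - a) \<le> norm (r - a)" if "s \<in> cball a (norm (r - a))" for s
    using that r by (auto simp: dist_norm norm_minus_commute)
  have bl_diff: "DF a (r - a) = DF a r - DF a a"
    by (rule linear_diff[OF bounded_linear.linear[OF bl]])
  have "norm (?G r - ?G a) \<le> K * norm (r - a) * norm (r - a)"
  proof (rule differentiable_bound[where S = "cball a (norm (r - a))" and f' = "\<lambda>s h. DF s h - DF a h"])
    show "convex (cball a (norm (r - a)))" by simp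
    show "(?G has_derivative (\<lambda>h. DF s h - DF a h)) (at s within cball a (norm (r - a)))"
      if "s \<in> cball a (norm (r - a))" for s
      by (intro has_derivative_diff has_derivative_at_withinI[OF der] sub that
          bounded_linear_imp_has_derivative bl)
    show "onorm (\<lambda>h. DF s h - DF a h) \<le> K * norm (r - a)"
      if "s \<in> cball a (norm (r - a))" for s
    proof (rule onorm_bound)
      show "0 \<le> K * norm (r - a)" using K by simp
      show "norm (DF s h - DF a h) \<le> K * norm (r - a) * norm h" for h
        using lip[OF sub(1)[OF that], of h] sub(2)[OF that] K
        by (meson mult_left_mono mult_right_mono norm_ge_zero order_trans)
    qed
  qed (auto simp: dist_norm norm_minus_commute)
  moreover have eq: "F r - F a - DF a (r - a) = ?G r - ?G a"
    unfolding bl_diff by simp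
  ultimately show 1: "norm (F r - F a - DF a (r - a)) \<le> K * (norm (r - a))\<^sup>2"
    unfolding eq by (simp add: power2_eq_square mult.assoc)
  have "norm (DF r (r - a) - (F r - F a))
      \<le> norm (DF r (r - a) - DF a (r - a)) + norm (F r - F a - DF a (r - a))"
    using norm_triangle_ineq4[of "DF r (r - a) - DF a (r - a)" "F r - F a - DF a (r - a)"] by simp
  then show "norm (DF r (r - a) - (F r - F a)) \<le> 2 * K * (norm (r - a))\<^sup>2"
    using 1 lip[OF r, of "r - a"] by (simp add: power2_eq_square mult.assoc)
qed

lemma norm_matrix_le_sum:
  fixes X :: "real^'m^'n"
  assumes "\<And>i j. \<bar>X$i$j\<bar> \<le> c i j"
  shows "norm X \<le> (\<Sum>i\<in>UNIV. \<Sum>j\<in>UNIV. c i j)"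
proof -
  have "norm X \<le> (\<Sum>i\<in>UNIV. norm (X$i))" unfolding norm_vec_def by (rule L2_set_le_sum) simp
  also have "\<dots> \<le> (\<Sum>i\<in>UNIV. \<Sum>j\<in>UNIV. c i j)"
    by (intro sum_mono order_trans[OF norm_le_l1_cart] assms)
  finally show ?thesis .
qed

text \<open>All that the convergence proof needs from twice differentiability: the Lipschitz bound at
  \<open>a\<close> controls the remainders, and the differentiability of \<open>DF\<close> at \<open>a\<close> serves to compute a
  Hessian there.\<close>

lemma C2_entries_derivative:
  fixes F :: "real^2 \<Rightarrow> real^'m^'n"
  assumes C2: "C2_entries_on S F" and S: "open S" "a \<in> S"
  obtains DF e K where "\<And>r. r \<in> S \<Longrightarrow> (F has_derivative DF r) (at r)"
    "\<And>h. (\<lambda>r. DF r h) differentiable (at a)"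
    "0 < e" "ball a e \<subseteq> S" "0 < K"
    "\<And>r h. r \<in> ball a e \<Longrightarrow> norm (DF r h - DF a h) \<le> K * norm (r - a) * norm h"
proof -
  have "\<forall>i j. \<exists>(f' :: real^2 \<Rightarrow> (real^2) \<Rightarrow>\<^sub>L real) (f'' :: real^2 \<Rightarrow> (real^2) \<Rightarrow>\<^sub>L ((real^2) \<Rightarrow>\<^sub>L real)).
      (\<forall>r\<in>S. ((\<lambda>r. F r $ i $ j) has_derivative blinfun_apply (f' r)) (at r)) \<and>
      (\<forall>r\<in>S. (f' has_derivative blinfun_apply (f'' r)) (at r))"
    using C2 unfolding C2_entries_on_def C2_on_def by metis
  then obtain f' :: "'n \<Rightarrow> 'm \<Rightarrow> real^2 \<Rightarrow> (real^2) \<Rightarrow>\<^sub>L real"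
    and f'' :: "'n \<Rightarrow> 'm \<Rightarrow> real^2 \<Rightarrow> (real^2) \<Rightarrow>\<^sub>L ((real^2) \<Rightarrow>\<^sub>L real)"
    where f': "\<And>i j r. r \<in> S \<Longrightarrow> ((\<lambda>r. F r $ i $ j) has_derivative blinfun_apply (f' i j r)) (at r)"
      and f'': "\<And>i j r. r \<in> S \<Longrightarrow> (f' i j has_derivative blinfun_apply (f'' i j r)) (at r)"
    by metis
  have "\<forall>i j. \<exists>K. 0 \<le> K \<and> (\<forall>\<^sub>F r in nhds a. norm (f' i j r - f' i j a) \<le> K * norm (r - a))"
  proof (intro allI)
    fix i j
    show "\<exists>K. 0 \<le> K \<and> (\<forall>\<^sub>F r in nhds a. norm (f' i j r - f' i j a) \<le> K * norm (r - a))"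
      by (rule has_derivative_locally_lipschitz[OF f''[OF S(2), of i j]]) blast
  qed
  then obtain K where K: "\<And>i j. 0 \<le> K i j"
    "\<And>i j. \<forall>\<^sub>F r in nhds a. norm (f' i j r - f' i j a) \<le> K i j * norm (r - a)"
    unfolding choice_iff by blast
  have "\<forall>\<^sub>F r in nhds a. r \<in> S \<and> (\<forall>i j. norm (f' i j r - f' i j a) \<le> K i j * norm (r - a))"
    using K(2) S by (simp add: eventually_conj_iff eventually_nhds_in_open eventually_all_finite)
  then obtain e where e: "e > 0" "\<And>r. dist r a < e \<Longrightarrow> r \<in> S"
    "\<And>r i j. dist r a < e \<Longrightarrow> norm (f' i j r - f' i j a) \<le> K i j * norm (r - a)"
    unfolding eventually_nhds_metric by blast
  define DF where "DF r h = (\<chi> i j. f' i j r h)" for r h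
  show ?thesis
  proof (rule that)
    show "(F has_derivative DF r) (at r)" if "r \<in> S" for r
      using f'[OF that] by (auto intro!: has_derivative_vec_nth simp: DF_def)
    show "(\<lambda>r. DF r h) differentiable (at a)" for h
      unfolding differentiable_def DF_def
      by (rule exI[of _ "\<lambda>k. \<chi> i j. f'' i j a k h"], intro has_derivative_vec_nth)
        (auto intro!: bounded_linear.has_derivative[OF blinfun.bounded_linear_left] f'' S)
    show "0 < e" "ball a e \<subseteq> S" using e by (auto simp: dist_commute)
    show "0 < 1 + (\<Sum>i\<in>UNIV. \<Sum>j\<in>UNIV. K i j)"
      using K(1) by (intro add_pos_nonneg sum_nonneg) auto
    show "norm (DF r h - DF a h) \<le> (1 + (\<Sum>i\<in>UNIV. \<Sum>j\<in>UNIV. K i j)) * norm (r - a) * norm h"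
      if "r \<in> ball a e" for r h
    proof -
      have "norm (DF r h - DF a h) \<le> (\<Sum>i\<in>UNIV. \<Sum>j\<in>UNIV. K i j * norm (r - a) * norm h)"
      proof (rule norm_matrix_le_sum)
        fix i j
        have "\<bar>(DF r h - DF a h) $ i $ j\<bar> = norm (blinfun_apply (f' i j r - f' i j a) h)"
          by (simp add: DF_def blinfun.diff_left)
        also have "\<dots> \<le> norm (f' i j r - f' i j a) * norm h" by (rule norm_blinfun)
        also have "\<dots> \<le> K i j * norm (r - a) * norm h"
          using e(3)[of r i j] that by (intro mult_right_mono) (auto simp: dist_commute)
        finally show "\<bar>(DF r h - DF a h) $ i $ j\<bar> \<le> K i j * norm (r - a) * norm h" .
      qed
      also have "\<dots> = (\<Sum>i\<in>UNIV. \<Sum>j\<in>UNIV. K i j) * (norm (r - a) * norm h)"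
        by (simp add: sum_distrib_right mult.assoc)
      also have "\<dots> \<le> (1 + (\<Sum>i\<in>UNIV. \<Sum>j\<in>UNIV. K i j)) * (norm (r - a) * norm h)"
        by (intro mult_right_mono) auto
      finally show ?thesis by (simp add: mult.assoc)
    qed
  qed
qed

lemma has_derivative_symmetric:
  fixes B :: "real^2 \<Rightarrow> real^'n^'n"
  assumes S: "open S" "r \<in> S" and B: "(B has_derivative DB) (at r)"
    and sym: "\<And>s. s \<in> S \<Longrightarrow> transpose (B s) = B s"
  shows "transpose (DB h) = DB h"
proof -
  have bl: "bounded_linear (transpose :: real^'n^'n \<Rightarrow> _)"
    by (rule linear_conv_bounded_linear[THEN iffD1])
      (auto intro!: linearI simp: transpose_def vec_eq_iff)
  have "((\<lambda>s. transpose (B s)) has_derivative (\<lambda>h. transpose (DB h))) (at r)"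
    by (rule bounded_linear.has_derivative[OF bl B])
  moreover have "((\<lambda>s. transpose (B s)) has_derivative DB) (at r)"
    by (rule has_derivative_transform_within_open[OF B S]) (simp add: sym)
  ultimately show ?thesis using has_derivative_unique by metis
qed

lemma partial_deriv_eq:
  assumes "(f has_derivative D) (at r)"
  shows "partial_deriv k f r = D (axis k 1)"
proof -
  have "((\<lambda>t. r + t *\<^sub>R axis k 1) has_derivative (\<lambda>t. t *\<^sub>R axis k 1)) (at 0)"
    by (auto intro!: derivative_eq_intros)
  then have "((\<lambda>t. f (r + t *\<^sub>R axis k 1)) has_derivative (\<lambda>t. D (t *\<^sub>R axis k 1))) (at 0)"
    using has_derivative_compose[of "\<lambda>t. r + t *\<^sub>R axis k 1" _ 0 UNIV f D] assms by simp
  moreover have "D (t *\<^sub>R axis k 1) = t *\<^sub>R D (axis k 1)" for t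
    using has_derivative_linear[OF assms] by (simp add: linear_scale)
  ultimately show ?thesis
    unfolding partial_deriv_def
    by (intro vector_derivative_at) (simp add: has_vector_derivative_def)
qed

lemma linear_axis_expansion_2:
  fixes D :: "real^2 \<Rightarrow> 'b::real_vector"
  assumes "linear D"
  shows "D x = x$1 *\<^sub>R D (axis 1 1) + x$2 *\<^sub>R D (axis 2 1)"
proof -
  have "x = x$1 *\<^sub>R axis 1 1 + x$2 *\<^sub>R axis 2 1"
    by (simp add: vec_eq_iff forall_2 axis_def)
  then have "D x = D (x$1 *\<^sub>R axis 1 1 + x$2 *\<^sub>R axis 2 1)" by (rule arg_cong)
  then show ?thesis by (simp add: linear_add[OF assms] linear_scale[OF assms])
qed

text \<open>In the product rule for \<open>2 F \<bullet> DF (axis j 1)\<close> the term with the second derivative of \<open>F\<close>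
  carries the factor \<open>F a = 0\<close>; what remains is twice the Gram matrix of the partial derivatives.\<close>

lemma hessian_norm_square:
  fixes F :: "real^2 \<Rightarrow> 'b::real_inner"
  assumes S: "open S" "a \<in> S"
    and F: "\<And>r. r \<in> S \<Longrightarrow> (F has_derivative DF r) (at r)"
    and DF: "\<And>h. (\<lambda>r. DF r h) differentiable (at a)"
    and F0: "F a = 0" and g: "\<And>r. r \<in> S \<Longrightarrow> g r = (norm (F r))\<^sup>2"
  shows "hessian g a $ i $ j = 2 * (DF a (axis i 1) \<bullet> DF a (axis j 1))"
proof -
  have 1: "partial_deriv j g r = 2 * (F r \<bullet> DF r (axis j 1))" if "r \<in> S" for r
  proof -
    have "((\<lambda>r. F r \<bullet> F r) has_derivative (\<lambda>h. F r \<bullet> DF r h + DF r h \<bullet> F r)) (at r)"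
      using F[OF that] by (intro has_derivative_inner)
    then have "(g has_derivative (\<lambda>h. F r \<bullet> DF r h + DF r h \<bullet> F r)) (at r)"
      by (rule has_derivative_transform_within_open[OF _ S(1) that])
        (simp add: g power2_norm_eq_inner)
    then show ?thesis by (simp add: partial_deriv_eq inner_commute)
  qed
  obtain D where D: "((\<lambda>r. DF r (axis j 1)) has_derivative D) (at a)"
    using DF[of "axis j 1"] by (auto simp: differentiable_def)
  have "((\<lambda>r. 2 * (F r \<bullet> DF r (axis j 1))) has_derivative
      (\<lambda>h. 2 * (F a \<bullet> D h + DF a h \<bullet> DF a (axis j 1)))) (at a)"
    using F[OF S(2)] D by (intro has_derivative_mult_right has_derivative_inner)
  then have "(partial_deriv j g has_derivative
      (\<lambda>h. 2 * (F a \<bullet> D h + DF a h \<bullet> DF a (axis j 1)))) (at a)"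
    by (rule has_derivative_transform_within_open[OF _ S]) (simp add: 1)
  then show ?thesis by (simp add: hessian_def partial_deriv_eq F0)
qed

lemma hessian_norm_square_invertible_imp_injective:
  fixes F :: "real^2 \<Rightarrow> 'b::real_inner"
  assumes "open S" "a \<in> S"
    and F: "\<And>r. r \<in> S \<Longrightarrow> (F has_derivative DF r) (at r)"
    and "\<And>h. (\<lambda>r. DF r h) differentiable (at a)"
    and "F a = 0" and "\<And>r. r \<in> S \<Longrightarrow> g r = (norm (F r))\<^sup>2"
    and inv: "invertible (hessian g a)" and x: "DF a x = 0"
  shows "x = 0"
proof -
  note H = hessian_norm_square[OF assms(1-6)]
  note exp = linear_axis_expansion_2[OF has_derivative_linear[OF F[OF \<open>a \<in> S\<close>]], of x]
  have "(hessian g a *v x) $ i = 2 * (DF a (axis i 1) \<bullet> DF a x)" for i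
    unfolding exp by (simp add: matrix_vector_mult_def sum_2 H inner_add_right algebra_simps)
  then have "hessian g a *v x = 0" by (simp add: vec_eq_iff x)
  then show ?thesis
    using inv unfolding invertible_left_inverse matrix_left_invertible_ker by blast
qed

lemma step_matrix_mult:
  assumes "(A has_derivative DA) (at r)"
  shows "step_matrix A r v1 v2 *v x = gap_vector v1 v2 (DA x)"
proof -
  note exp = linear_axis_expansion_2[OF has_derivative_linear[OF assms], of x]
  show ?thesis
    unfolding exp linear_add[OF linear_gap_vector] linear_scale[OF linear_gap_vector]
    by (simp add: step_matrix_def Let_def partial_deriv_eq[OF assms] gap_vector_def
        vec_eq_iff forall_2 matrix_vector_mult_def sum_2 algebra_simps)
qed

section \<open>Reduction to the block\<close>

definition block_part :: "(2 \<Rightarrow> 'n) \<Rightarrow> real^'n \<Rightarrow> real^2" where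
  "block_part p u = (\<chi> a. u $ p a)"

definition off_block_part :: "(2 \<Rightarrow> 'n) \<Rightarrow> real^'n \<Rightarrow> real^'n" where
  "off_block_part p u = (\<chi> i. if i \<in> range p then 0 else u $ i)"

lemma sum_supported_in_range:
  fixes p :: "2 \<Rightarrow> 'n::finite"
  assumes "inj p" "\<And>i. i \<notin> range p \<Longrightarrow> f i = 0"
  shows "(\<Sum>i\<in>UNIV. f i) = (\<Sum>a\<in>UNIV. f (p a))"
proof -
  have "(\<Sum>i\<in>UNIV. f i) = (\<Sum>i\<in>range p. f i)"
    using assms(2) by (intro sum.mono_neutral_right) auto
  also have "\<dots> = (\<Sum>a\<in>UNIV. f (p a))" using assms(1) by (simp add: sum.reindex)
  finally show ?thesis .
qed

lemma block_part_direct_sum: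
  fixes p :: "2 \<Rightarrow> 'n::finite"
  assumes "inj p" "is_direct_sum p D B L"
  shows "block_part p (D *v u) = B *v block_part p u"
proof -
  have "(\<Sum>j\<in>UNIV. D $ p a $ j * u $ j) = (\<Sum>b\<in>UNIV. D $ p a $ p b * u $ p b)" for a
    using assms by (intro sum_supported_in_range) (auto simp: is_direct_sum_def)
  then show ?thesis
    using assms(2) by (simp add: vec_eq_iff block_part_def matrix_vector_mult_def is_direct_sum_def)
qed

lemma inner_block_part:
  fixes p :: "2 \<Rightarrow> 'n::finite"
  assumes "inj p" "off_block_part p u = 0"
  shows "u \<bullet> x = block_part p u \<bullet> block_part p x"
proof -
  have "u $ i = 0" if "i \<notin> range p" for i
    using arg_cong[OF assms(2), of "\<lambda>x. x $ i"] that by (simp add: off_block_part_def)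
  then have "(\<Sum>i\<in>UNIV. u $ i * x $ i) = (\<Sum>a\<in>UNIV. u $ p a * x $ p a)"
    using assms(1) by (intro sum_supported_in_range) auto
  then show ?thesis by (simp add: inner_vec_def block_part_def)
qed

lemma off_block_part_eigenvector:
  fixes p :: "2 \<Rightarrow> 'n::finite"
  assumes "is_direct_sum p D B L" "D *v u = t *\<^sub>R u"
  shows "D *v off_block_part p u = t *\<^sub>R off_block_part p u"
proof (simp add: vec_eq_iff, rule allI)
  fix i
  show "(D *v off_block_part p u) $ i = t * off_block_part p u $ i"
  proof (cases "i \<in> range p")
    case True
    then obtain a where i: "i = p a" by auto
    have z: "D $ p a $ j * off_block_part p u $ j = 0" for j
      using assms(1) by (auto simp: is_direct_sum_def off_block_part_def)
    have "(D *v off_block_part p u) $ p a = 0" by (simp add: matrix_vector_mult_def z)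
    then show ?thesis by (simp add: off_block_part_def i)
  next
    case False
    have z: "D $ i $ j * off_block_part p u $ j = D $ i $ j * u $ j" for j
      using assms(1) False by (auto simp: is_direct_sum_def off_block_part_def)
    have "(D *v off_block_part p u) $ i = (D *v u) $ i"
      unfolding matrix_vector_mult_def by (simp only: vec_lambda_beta z)
    then show ?thesis using False by (simp add: assms(2) off_block_part_def)
  qed
qed

lemma inner_orthogonal_matrix:
  fixes M :: "real^'n^'n"
  assumes "orthogonal_matrix M"
  shows "(M *v u) \<bullet> (M *v v) = u \<bullet> v"
  using orthogonal_transformation_matrix[of "(*v) M"] assms
  by (simp add: orthogonal_transformation_def)

text \<open>The block already accounts for two dimensions of the lowest eigenspace, so an eigenvector in
  the complement would be a third one and force \<open>\<lambda>\<^sub>3 = \<lambda>\<^sub>1\<close>.\<close>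

lemma no_eigenvector_outside_block:
  fixes A M :: "real^'n^'n" and p :: "2 \<Rightarrow> 'n"
  assumes sym: "transpose A = A" and M: "orthogonal_matrix M" and p: "inj p"
    and D: "D = transpose M ** A ** M" "is_direct_sum p D B L"
    and B: "\<And>w. B *v w = t *\<^sub>R w"
    and t: "nth_eigenvalue 1 A = t" "CARD('n) \<ge> 3 \<Longrightarrow> t < nth_eigenvalue 3 A"
    and x: "block_part p x = 0" "D *v x = t *\<^sub>R x"
  shows "x = 0"
proof (rule ccontr)
  assume x0: "x \<noteq> 0"
  have E: "M *v u \<in> eigenspace A t" if "D *v u = t *\<^sub>R u" for u
  proof -
    have "M *v (D *v u) = (M ** transpose M) *v (A *v (M *v u))"
      by (simp add: D(1) matrix_vector_mul_assoc matrix_mul_assoc)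
    also have "\<dots> = A *v (M *v u)" using M by (simp add: orthogonal_matrix_def)
    finally show ?thesis using that by (simp add: eigenspace_def matrix_vector_mult_scaleR)
  qed
  define e where "e a = (axis (p a) 1 :: real^'n)" for a
  have De: "D *v e a = t *\<^sub>R e a" for a
  proof -
    have "column a B = t *\<^sub>R axis a 1"
      using B[of "axis a 1"] by (simp add: matrix_vector_mult_basis)
    then have Bcol: "B $ b $ a = (if b = a then t else 0)" for b
      by (simp add: vec_eq_iff column_def axis_def)
    have "D $ i $ p a = (if i = p a then t else 0)" for i
    proof (cases "i \<in> range p")
      case True
      then show ?thesis using D(2) p by (auto simp: is_direct_sum_def Bcol inj_eq)
    next
      case False
      then show ?thesis using D(2) by (auto simp: is_direct_sum_def)
    qed
    moreover have "D *v e a = column (p a) D" by (simp add: e_def matrix_vector_mult_basis)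
    ultimately show ?thesis by (simp add: vec_eq_iff e_def column_def axis_def)
  qed
  let ?T = "{M *v e 1, M *v e 2, M *v x}"
  have "axis (p 2) 1 $ p 1 = (0 :: real)" using p by (simp add: axis_def inj_eq)
  then have "e 1 \<bullet> e 2 = 0" "e a \<bullet> x = 0" "e a \<bullet> e a = 1" for a
    using p arg_cong[OF x(1), of "\<lambda>y. y $ a"]
    by (simp_all add: e_def inner_axis' block_part_def)
  then have i: "(M *v e 1) \<bullet> (M *v e 2) = 0" "(M *v e a) \<bullet> (M *v x) = 0"
    "(M *v e a) \<bullet> (M *v e a) = 1" "(M *v x) \<bullet> (M *v x) \<noteq> 0" for a
    using x0 by (simp_all add: inner_orthogonal_matrix[OF M])
  have "independent ?T"
  proof (rule pairwise_orthogonal_independent)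
    show "pairwise orthogonal ?T" using i by (auto simp: pairwise_def orthogonal_def inner_commute)
    show "0 \<notin> ?T" using i(3)[of 1] i(3)[of 2] i(4) by auto
  qed
  moreover have "card ?T = 3"
  proof -
    have "M *v e 1 \<noteq> M *v e 2" "M *v e 1 \<noteq> M *v x" "M *v e 2 \<noteq> M *v x"
      using i(1) i(2)[of 1] i(2)[of 2] i(3)[of 1] i(3)[of 2] by auto
    then show ?thesis by simp
  qed
  moreover have "?T \<subseteq> eigenspace A t" using E De x(2) by auto
  ultimately have d: "3 \<le> dim (eigenspace A t)"
    using independent_card_le_dim[of ?T "eigenspace A t"] by simp
  have "3 \<le> CARD('n)" using d dim_subset_UNIV[of "eigenspace A t"] by simp
  moreover have "nth_eigenvalue 3 A = t" using nth_eigenvalue_3_eq_1[OF sym] d t(1) by simp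
  ultimately show False using t(2) by simp
qed

text \<open>Stability of the previous fact: invertibility of \<open>D0 - t0\<close> on the complement of the block
  survives small changes of \<open>D0\<close> and \<open>t0\<close>, and the complementary part of an eigenvector is
  again an eigenvector.\<close>

lemma eigenvector_supported_in_block:
  fixes p :: "2 \<Rightarrow> 'n::finite"
  assumes "is_direct_sum p D B L"
    and gap: "\<And>x. block_part p x = 0 \<Longrightarrow> c * norm x \<le> norm (D0 *v x - t0 *\<^sub>R x)"
    and near: "norm (D - D0) + \<bar>t - t0\<bar> < c"
    and u: "D *v u = t *\<^sub>R u"
  shows "off_block_part p u = 0"
proof (rule ccontr)
  let ?x = "off_block_part p u"
  assume x0: "?x \<noteq> 0"
  have block0: "block_part p ?x = 0" by (simp add: block_part_def off_block_part_def vec_eq_iff)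
  have "D0 *v ?x - t0 *\<^sub>R ?x = (t - t0) *\<^sub>R ?x - (D - D0) *v ?x"
    using off_block_part_eigenvector[OF assms(1) u]
    by (simp add: matrix_vector_mult_diff_rdistrib algebra_simps)
  then have "c * norm ?x \<le> norm ((t - t0) *\<^sub>R ?x - (D - D0) *v ?x)"
    using gap[of ?x] block0 by simp
  also have "\<dots> \<le> \<bar>t - t0\<bar> * norm ?x + norm (D - D0) * norm ?x"
    using norm_triangle_ineq4 norm_matrix_vector_le
    by (metis (no_types, opaque_lifting) add_left_mono norm_scaleR order_trans)
  finally have "c \<le> norm (D - D0) + \<bar>t - t0\<bar>"
    using x0 by (simp add: distrib_right[symmetric])
  then show False using near by simp
qed

lemma spectrum_dist_scalar:
  fixes X B :: "real^'n^'n"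
  assumes "t \<in> spectrum X" "\<And>w. B *v w = l *\<^sub>R w"
  shows "\<bar>t - l\<bar> \<le> norm (X - B)"
proof -
  obtain w where w: "w \<noteq> 0" "X *v w = t *\<^sub>R w"
    using assms(1) by (auto simp: spectrum_def eigenspace_def)
  have "(t - l) *\<^sub>R w = (X - B) *v w"
    by (simp add: matrix_vector_mult_diff_rdistrib assms(2) w algebra_simps)
  then have "\<bar>t - l\<bar> * norm w \<le> norm (X - B) * norm w"
    by (metis norm_matrix_vector_le norm_scaleR)
  then show ?thesis using w by simp
qed

lemma has_derivative_matrix_vector_mult:
  fixes X :: "'a::real_normed_vector \<Rightarrow> real^'n^'m"
  assumes "(X has_derivative DX) (at r)" "(u has_derivative Du) (at r)"
  shows "((\<lambda>s. X s *v u s) has_derivative (\<lambda>h. X r *v Du h + DX h *v u r)) (at r)"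
proof -
  have "bilinear (\<lambda>(X :: real^'n^'m) u. X *v u)"
    by (auto simp: bilinear_def intro!: linearI matrix_vector_mul_linear
        matrix_vector_mult_add_rdistrib scaleR_matrix_vector_assoc[symmetric])
  then have "bounded_bilinear (\<lambda>(X :: real^'n^'m) u. X *v u)"
    by (simp add: bilinear_conv_bounded_bilinear)
  from bounded_bilinear.FDERIV[OF this assms] show ?thesis .
qed

text \<open>Only the frame \<open>M\<close> moves, while the coefficient vectors \<open>u, u'\<close> are fixed: eigenvectors of
  \<open>A\<close> are in general not differentiable functions of the point. The derivatives of \<open>M\<close> enter through \<open>A\<close> applied to
  eigenvectors, that is with factors \<open>t\<close> and \<open>t'\<close>, and they cancel up to \<open>t - t'\<close> because
  the inner product of \<open>M u\<close> and \<open>M u'\<close> is constant.\<close>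

lemma inner_derivative_moving_frame:
  fixes A M :: "real^2 \<Rightarrow> real^'n^'n" and B :: "real^2 \<Rightarrow> real^'m^'m"
  assumes S: "open S" "r \<in> S"
    and A: "(A has_derivative DA) (at r)" and M: "(M has_derivative DM) (at r)"
    and B: "(B has_derivative DB) (at r)"
    and orth: "\<And>s. s \<in> S \<Longrightarrow> orthogonal_matrix (M s)"
    and block: "\<And>s. s \<in> S \<Longrightarrow> (M s *v u) \<bullet> (A s *v (M s *v u')) = w \<bullet> (B s *v w')"
    and sym: "transpose (A r) = A r"
    and ev: "A r *v (M r *v u) = t *\<^sub>R (M r *v u)" "A r *v (M r *v u') = t' *\<^sub>R (M r *v u')"
  shows "(M r *v u) \<bullet> (DA h *v (M r *v u'))
      = w \<bullet> (DB h *v w') + (t - t') * ((DM h *v u) \<bullet> (M r *v u'))"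
proof -
  have dM: "((\<lambda>s. M s *v u) has_derivative (\<lambda>h. DM h *v u)) (at r)" for u
    using has_derivative_matrix_vector_mult[OF M has_derivative_const[of u]] by simp
  have "((\<lambda>s. (M s *v u) \<bullet> (M s *v u')) has_derivative
      (\<lambda>h. (M r *v u) \<bullet> (DM h *v u') + (DM h *v u) \<bullet> (M r *v u'))) (at r)"
    by (intro has_derivative_inner dM)
  moreover have "((\<lambda>s. (M s *v u) \<bullet> (M s *v u')) has_derivative (\<lambda>h. 0)) (at r)"
    by (rule has_derivative_transform_within_open[OF has_derivative_const[of "u \<bullet> u'"] S])
      (simp add: inner_orthogonal_matrix orth)
  ultimately have 1: "(M r *v u) \<bullet> (DM h *v u') + (DM h *v u) \<bullet> (M r *v u') = 0"
    using has_derivative_unique by (metis (no_types, lifting))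
  have "((\<lambda>s. (M s *v u) \<bullet> (A s *v (M s *v u'))) has_derivative
      (\<lambda>h. (M r *v u) \<bullet> (A r *v (DM h *v u') + DA h *v (M r *v u'))
          + (DM h *v u) \<bullet> (A r *v (M r *v u')))) (at r)"
    by (intro has_derivative_inner dM has_derivative_matrix_vector_mult A)
  moreover have "((\<lambda>s. w \<bullet> (B s *v w')) has_derivative (\<lambda>h. w \<bullet> (DB h *v w'))) (at r)"
    using has_derivative_inner_right[OF has_derivative_matrix_vector_mult[OF B has_derivative_const[of w']]]
    by simp
  then have "((\<lambda>s. (M s *v u) \<bullet> (A s *v (M s *v u'))) has_derivative (\<lambda>h. w \<bullet> (DB h *v w'))) (at r)"
    by (rule has_derivative_transform_within_open[OF _ S]) (simp add: block)
  ultimately have "(M r *v u) \<bullet> (A r *v (DM h *v u') + DA h *v (M r *v u'))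
          + (DM h *v u) \<bullet> (A r *v (M r *v u')) = w \<bullet> (DB h *v w')"
    using has_derivative_unique by (metis (no_types, lifting))
  moreover have "(M r *v u) \<bullet> (A r *v (DM h *v u')) = t * ((M r *v u) \<bullet> (DM h *v u'))"
    by (metis dot_lmul_matrix ev(1) inner_scaleR_left sym vector_transpose_matrix)
  ultimately show ?thesis using 1 ev(2)
    by (simp add: inner_add_right algebra_simps) (simp add: eq_neg_iff_add_eq_0[symmetric])
qed

section \<open>Quadratic convergence\<close>

text \<open>The error \<open>e\<close> of the new point satisfies \<open>S *v e = S *v (r - a) - b\<close>.\<close>

lemma perturbed_newton_step:
  fixes S :: "real^'n^'n"
  assumes lower: "\<And>x. c * norm x \<le> norm (S *v x)" and c: "0 < c"
    and res: "norm (S *v (r - a) - b) \<le> C"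
  shows "invertible S" "norm (r - matrix_inv S *v b - a) \<le> C / c"
proof -
  have "x = 0" if "S *v x = 0" for x
    using lower[of x] c that by (simp add: mult_le_0_iff)
  then show inv: "invertible S"
    unfolding invertible_left_inverse matrix_left_invertible_ker by blast
  have "S *v (matrix_inv S *v b) = b"
  proof -
    have "S ** matrix_inv S = mat 1"
      unfolding matrix_inv_def using inv unfolding invertible_def by (rule someI2_ex) simp
    then show ?thesis by (simp add: matrix_vector_mul_assoc)
  qed
  then have "S *v (r - matrix_inv S *v b - a) = S *v (r - a) - b"
    by (simp add: matrix_vector_mult_diff_distrib)
  then have "c * norm (r - matrix_inv S *v b - a) \<le> C"
    using lower[of "r - matrix_inv S *v b - a"] res by simp
  then show "norm (r - matrix_inv S *v b - a) \<le> C / c"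
    using c by (simp add: field_simps)
qed

text \<open>The estimates at a single point \<open>r\<close>, with \<open>d\<close> the distance to the conical point,
  \<open>B0\<close> and \<open>DB0\<close> the values there and \<open>B\<close>, \<open>DB\<close> those at \<open>r\<close>. Every gap vector relative to the
  eigenbasis \<open>w1, w2\<close> is replaced by a coordinate gap of the same length; the constants then do
  not depend on the eigenbasis. \<open>m\<close> measures the error made by using the derivative of the full
  matrix instead of the block.\<close>

lemma perturbed_coordinate_gap_estimates:
  fixes DB :: "real^2 \<Rightarrow> real^2^2"
  assumes G: "\<And>X. norm (coordinate_gap X) \<le> G * norm X" "0 \<le> G"
    and lin: "linear DB" and c: "\<And>x. c * norm x \<le> norm (coordinate_gap (DB0 x))"
    and lip: "\<And>x. norm (DB x - DB0 x) \<le> K * d * norm x"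
    and S: "\<And>x. norm (S *v x - gap_vector w1 w2 (DB x)) \<le> m * d * norm x"
    and sym: "\<And>x. transpose (DB x) = DB x" "transpose B = B" "transpose B0 = B0"
    and w: "norm w1 = 1" "norm w2 = 1" "w1 \<bullet> w2 = 0"
    and B0: "coordinate_gap B0 = 0"
    and rem: "norm (DB y - (B - B0)) \<le> K' * d\<^sup>2" and y: "norm y = d"
  shows "(c - (G * K + m) * d) * norm x \<le> norm (S *v x)"
    "norm (S *v y - gap_vector w1 w2 B) \<le> (G * K' + m) * d\<^sup>2"
proof -
  note rot = norm_gap_vector_orthonormal[OF _ w]
  have "norm (coordinate_gap (DB0 x)) \<le> norm (coordinate_gap (DB x)) + norm (coordinate_gap (DB x - DB0 x))"
    using norm_triangle_ineq4[of "coordinate_gap (DB x)" "coordinate_gap (DB x - DB0 x)"]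
    by (simp add: linear_diff[OF linear_coordinate_gap])
  moreover have "norm (coordinate_gap (DB x - DB0 x)) \<le> G * (K * d * norm x)"
    using G(1)[of "DB x - DB0 x"] mult_left_mono[OF lip G(2), of x] by linarith
  moreover have "norm (coordinate_gap (DB x)) \<le> norm (S *v x) + m * d * norm x"
    unfolding rot[OF sym(1), symmetric]
    using S[of x] norm_triangle_ineq4[of "S *v x" "S *v x - gap_vector w1 w2 (DB x)"] by simp
  ultimately show "(c - (G * K + m) * d) * norm x \<le> norm (S *v x)"
    using c[of x] by (simp add: algebra_simps)
  have symR: "transpose (DB y - (B - B0)) = DB y - (B - B0)"
    using symmetric_entry[OF sym(1)[of y]] symmetric_entry[OF sym(2)] symmetric_entry[OF sym(3)]
    by (simp add: transpose_def vec_eq_iff)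
  have "gap_vector w1 w2 B0 = 0" using rot[OF sym(3)] B0 by simp
  then have eq: "S *v y - gap_vector w1 w2 B
      = (S *v y - gap_vector w1 w2 (DB y)) + gap_vector w1 w2 (DB y - (B - B0))"
    by (simp add: linear_diff[OF linear_gap_vector])
  have "norm (S *v y - gap_vector w1 w2 B)
      \<le> norm (S *v y - gap_vector w1 w2 (DB y)) + norm (gap_vector w1 w2 (DB y - (B - B0)))"
    unfolding eq by (rule norm_triangle_ineq)
  also have "\<dots> \<le> m * d * d + G * (K' * d\<^sup>2)"
    unfolding rot[OF symR]
    using S[of y] G(1)[of "DB y - (B - B0)"] mult_left_mono[OF rem G(2)] y by (intro add_mono) auto
  finally show "norm (S *v y - gap_vector w1 w2 B) \<le> (G * K' + m) * d\<^sup>2"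
    by (simp add: power2_eq_square algebra_simps)
qed

theorem theorem1p1:
  fixes A :: "real^2 \<Rightarrow> real^'n^'n" and \<alpha> :: "real^2"
  assumes "CARD('n) \<ge> 2"
    and "\<And>r. transpose (A r) = A r"
    and "C2_entries_on UNIV A"
    and "nondegenerate_conical_point A \<alpha>"
  shows "\<exists>\<Omega> C. open \<Omega> \<and> \<alpha> \<in> \<Omega> \<and> C > 0 \<and>
    (\<forall>r\<in>\<Omega>. \<forall>v1 v2. lowest_eigenpair (A r) v1 v2 \<longrightarrow>
       invertible (step_matrix A r v1 v2) \<and>
       norm (next_iterate A r v1 v2 - \<alpha>) \<le> C * (norm (r - \<alpha>))\<^sup>2)"
proof -
  note symA = assms(2)
  obtain \<Omega>0 M p B L where \<Omega>0: "open \<Omega>0" "\<alpha> \<in> \<Omega>0" and block: "block_reduction A \<Omega>0 M p B L"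
    and nondeg: "nondegenerate_critical_point (\<lambda>r. disc (B r)) \<alpha>"
    using assms(4) unfolding nondegenerate_conical_point_def by blast
  have p: "inj p" and C2M: "C2_entries_on \<Omega>0 M" and C2B: "C2_entries_on \<Omega>0 B"
    using block by (auto simp: block_reduction_def)
  define D where "D r = transpose (M r) ** A r ** M r" for r
  have Dv: "D r *v x = transpose (M r) *v (A r *v (M r *v x))" for r x
    by (simp only: D_def matrix_vector_mul_assoc matrix_mul_assoc)
  have orth: "orthogonal_matrix (M r)" and ds: "is_direct_sum p (D r) (B r) (L r)"
    and symB: "transpose (B r) = B r"
    and ev: "nth_eigenvalue 1 (B r) = nth_eigenvalue 1 (A r)"
      "nth_eigenvalue 2 (B r) = nth_eigenvalue 2 (A r)"
    if "r \<in> \<Omega>0" for r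
    using block that by (auto simp: block_reduction_def D_def)
  obtain DA where DA: "\<And>r. (A has_derivative DA r) (at r)"
    using C2_entries_derivative[OF assms(3) open_UNIV UNIV_I, of \<alpha>] by (metis UNIV_I)
  obtain DM eM KM where DM: "\<And>r. r \<in> \<Omega>0 \<Longrightarrow> (M has_derivative DM r) (at r)"
    and eM: "0 < eM" "ball \<alpha> eM \<subseteq> \<Omega>0" "0 < KM"
    and lipM: "\<And>r h. r \<in> ball \<alpha> eM \<Longrightarrow> norm (DM r h - DM \<alpha> h) \<le> KM * norm (r - \<alpha>) * norm h"
    using C2_entries_derivative[OF C2M \<Omega>0] by metis
  obtain DB eB KB where DB: "\<And>r. r \<in> \<Omega>0 \<Longrightarrow> (B has_derivative DB r) (at r)"
    and diffDB: "\<And>h. (\<lambda>r. DB r h) differentiable (at \<alpha>)"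
    and eB: "0 < eB" "ball \<alpha> eB \<subseteq> \<Omega>0" "0 < KB"
    and lipB: "\<And>r h. r \<in> ball \<alpha> eB \<Longrightarrow> norm (DB r h - DB \<alpha> h) \<le> KB * norm (r - \<alpha>) * norm h"
    using C2_entries_derivative[OF C2B \<Omega>0] by metis
  have "(B has_derivative DB s) (at s)" if "s \<in> ball \<alpha> eB" for s
    using DB eB(2) that by blast
  note estB = first_order_estimates[OF this lipB less_imp_le[OF eB(3)]]

  define t where "t = nth_eigenvalue 1 (A \<alpha>)"
  have t: "nth_eigenvalue 1 (B \<alpha>) = t" "nth_eigenvalue 2 (B \<alpha>) = t"
    using assms(4) ev[OF \<Omega>0(2)] by (auto simp: t_def nondegenerate_conical_point_def)
  note B\<alpha> = equal_eigenvalues_2_scalar[OF symB[OF \<Omega>0(2)] t]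
  have t3: "CARD('n) \<ge> 3 \<Longrightarrow> t < nth_eigenvalue 3 (A \<alpha>)"
    using assms(4) by (auto simp: t_def nondegenerate_conical_point_def)

  obtain G where G: "0 < G" "\<And>X. norm (coordinate_gap X) \<le> G * norm X"
    using linear_bounded_pos[OF linear_coordinate_gap] by metis
  have blG: "bounded_linear coordinate_gap"
    using linear_coordinate_gap by (simp add: linear_conv_bounded_linear)
  define F where "F r = coordinate_gap (B r)" for r
  define DF where "DF r h = coordinate_gap (DB r h)" for r h
  have DF: "(F has_derivative DF r) (at r)" if "r \<in> \<Omega>0" for r
    unfolding F_def DF_def by (rule bounded_linear.has_derivative[OF blG DB[OF that]])
  have diffDF: "(\<lambda>r. DF r h) differentiable (at \<alpha>)" for h
    using diffDB[of h] bounded_linear.has_derivative[OF blG]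
    unfolding DF_def differentiable_def by blast
  have discF: "disc (B r) = (norm (F r))\<^sup>2" if "r \<in> \<Omega>0" for r
    by (simp add: disc_eq[OF symB[OF that]] F_def coordinate_gap_eq norm_vector_2)
  have F0: "F \<alpha> = 0" by (simp add: F_def B\<alpha>)
  have inj: "x = 0" if "DF \<alpha> x = 0" for x
    by (rule hessian_norm_square_invertible_imp_injective[where F = F and g = "\<lambda>r. disc (B r)", OF \<Omega>0 DF diffDF F0 discF _ that])
      (use nondeg in \<open>auto simp: nondegenerate_critical_point_def\<close>)
  \<comment> \<open>\<open>\<alpha>\<close> is a simple zero of \<open>F\<close>\<close>
  obtain c where c: "0 < c" "\<And>x. c * norm x \<le> norm (DF \<alpha> x)"
    using injective_imp_isometric[OF closed_UNIV subspace_UNIV has_derivative_bounded_linear[OF DF[OF \<Omega>0(2)]]] inj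
    by blast

  \<comment> \<open>a spectral gap \<open>\<gamma>\<close> between \<open>t\<close> and the complementary block, and the region where it persists\<close>
  have "closed {x. block_part p x = 0}" "subspace {x. block_part p x = 0}"
    by (auto simp: closed_subspace subspace_def block_part_def vec_eq_iff)
  moreover have "bounded_linear (\<lambda>x. D \<alpha> *v x - t *\<^sub>R x)"
    by (intro bounded_linear_intros matrix_vector_mul_bounded_linear)
  moreover have "x = 0" if "block_part p x = 0" "D \<alpha> *v x - t *\<^sub>R x = 0" for x
    using no_eigenvector_outside_block[OF symA orth[OF \<Omega>0(2)] p D_def ds[OF \<Omega>0(2)] B\<alpha>(1) t_def[symmetric] t3 that(1)] that(2)
    by simp
  ultimately obtain \<gamma> where \<gamma>: "0 < \<gamma>"
    "\<And>x. block_part p x = 0 \<Longrightarrow> \<gamma> * norm x \<le> norm (D \<alpha> *v x - t *\<^sub>R x)"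
    using injective_imp_isometric[of "{x. block_part p x = 0}" "\<lambda>x. D \<alpha> *v x - t *\<^sub>R x"] by blast

  have cont: "A \<midarrow>\<alpha>\<rightarrow> A \<alpha>" "M \<midarrow>\<alpha>\<rightarrow> M \<alpha>" "B \<midarrow>\<alpha>\<rightarrow> B \<alpha>"
    using has_derivative_continuous[OF DA] has_derivative_continuous[OF DM[OF \<Omega>0(2)]]
      has_derivative_continuous[OF DB[OF \<Omega>0(2)]] by (auto simp: isCont_def)
  have contD: "D \<midarrow>\<alpha>\<rightarrow> D \<alpha>"
    unfolding D_def matrix_matrix_mult_def transpose_def
    by (intro tendsto_intros cont)
  define dev where "dev r = norm (D r - D \<alpha>) + norm (B r - B \<alpha>)" for r
  have "dev \<midarrow>\<alpha>\<rightarrow> dev \<alpha>"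
    unfolding dev_def by (intro tendsto_intros cont contD)
  then have "(dev \<longlongrightarrow> dev \<alpha>) (nhds \<alpha>)" by (simp only: tendsto_at_iff_tendsto_nhds)
  then have "\<forall>\<^sub>F r in nhds \<alpha>. dev r < \<gamma>"
    by (rule order_tendstoD(2)) (simp add: dev_def \<gamma>(1))
  then obtain e1 where e1: "0 < e1"
    "\<And>r. dist r \<alpha> < e1 \<Longrightarrow> norm (D r - D \<alpha>) + norm (B r - B \<alpha>) < \<gamma>"
    unfolding eventually_nhds_metric dev_def by blast

  obtain KM0 where KM0: "0 < KM0" "\<And>h. norm (DM \<alpha> h) \<le> KM0 * norm h"
    using linear_bounded_pos[OF has_derivative_linear[OF DM[OF \<Omega>0(2)]]] by metis
  obtain KB0 where KB0: "0 < KB0" "\<And>h. norm (DB \<alpha> h) \<le> KB0 * norm h"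
    using linear_bounded_pos[OF has_derivative_linear[OF DB[OF \<Omega>0(2)]]] by metis

  \<comment> \<open>\<open>2 * \<bar>\<lambda>\<^sub>1 - \<lambda>\<^sub>2\<bar> * norm (DM r h) \<le> m * d * norm h\<close>; the radius \<open>c / (2 * C1)\<close> keeps half of the lower bound \<open>c\<close>\<close>
  define m where "m = 2 * (G * (KB0 + KB)) * (KM0 + KM)"
  define C1 where "C1 = G * (2 * KB) + m"
  have m: "0 < m" using G KB0 KM0 eM eB by (simp add: m_def)
  have C1: "0 < C1" using G eB m by (simp add: C1_def add_pos_pos)
  define e where "e = Min {1, eM, eB, e1, c / (2 * C1)}"
  have e: "0 < e" "e \<le> 1" "e \<le> eM" "e \<le> eB" "e \<le> e1" "e \<le> c / (2 * C1)"
    using eM eB e1 c C1 by (simp_all add: e_def)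

  have main: "invertible (step_matrix A r v1 v2) \<and>
       norm (next_iterate A r v1 v2 - \<alpha>) \<le> (C1 / (c / 2)) * (norm (r - \<alpha>))\<^sup>2"
    if r: "r \<in> ball \<alpha> e" and low: "lowest_eigenpair (A r) v1 v2" for r v1 v2
  proof -
    define d where "d = norm (r - \<alpha>)"
    have d: "0 \<le> d" "d < e" using r by (auto simp: d_def dist_norm norm_minus_commute)
    have rM: "r \<in> ball \<alpha> eM" and rB: "r \<in> ball \<alpha> eB" and r1: "dist r \<alpha> < e1"
      using r e by (auto simp: dist_commute)
    have r0: "r \<in> \<Omega>0" using rM eM by blast
    note orthr = orth[OF r0] and dsr = ds[OF r0] and symBr = symB[OF r0]
    define t1 t2 where "t1 = nth_eigenvalue 1 (A r)" and "t2 = nth_eigenvalue 2 (A r)"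
    have v: "norm v1 = 1" "norm v2 = 1" "v1 \<bullet> v2 = 0" "A r *v v1 = t1 *\<^sub>R v1" "A r *v v2 = t2 *\<^sub>R v2"
      using low by (auto simp: lowest_eigenpair_def t1_def t2_def)
    \<comment> \<open>\<open>u\<close>: eigenvectors in the frame \<open>M r\<close>; \<open>w\<close>: their coordinates in the block, an eigenbasis of \<open>B r\<close>\<close>
    define u1 u2 where "u1 = transpose (M r) *v v1" and "u2 = transpose (M r) *v v2"
    have Mu: "M r *v u1 = v1" "M r *v u2 = v2"
      using orthr unfolding u1_def u2_def orthogonal_matrix_def matrix_vector_mul_assoc
      by (simp_all only: matrix_vector_mul_lid)
    have u: "norm u1 = 1" "norm u2 = 1" "u1 \<bullet> u2 = 0"
      using v(1-3) by (simp_all add: Mu[symmetric] inner_orthogonal_matrix[OF orthr] norm_eq_sqrt_inner)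
    have Du: "D r *v u1 = t1 *\<^sub>R u1" "D r *v u2 = t2 *\<^sub>R u2"
      by (simp_all only: Dv Mu v(4,5) matrix_vector_mult_scaleR u1_def[symmetric] u2_def[symmetric])
    have "norm (D r - D \<alpha>) + \<bar>s - t\<bar> < \<gamma>" if "s \<in> spectrum (B r)" for s
      using spectrum_dist_scalar[OF that B\<alpha>(1)] e1(2)[OF r1] by simp
    then have near: "norm (D r - D \<alpha>) + \<bar>t1 - t\<bar> < \<gamma>" "norm (D r - D \<alpha>) + \<bar>t2 - t\<bar> < \<gamma>"
      using nth_eigenvalue_2_in_spectrum[OF symBr] unfolding ev[OF r0] t1_def t2_def by blast+
    have off: "off_block_part p u1 = 0" "off_block_part p u2 = 0"
      using eigenvector_supported_in_block[OF dsr \<gamma>(2)] near Du by blast+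
    define w1 w2 where "w1 = block_part p u1" and "w2 = block_part p u2"
    have w: "norm w1 = 1" "norm w2 = 1" "w1 \<bullet> w2 = 0"
      using u inner_block_part[OF p off(1), of u1] inner_block_part[OF p off(1), of u2]
        inner_block_part[OF p off(2), of u2] by (simp_all add: w1_def w2_def norm_eq_sqrt_inner)
    have Bw: "B r *v w1 = t1 *\<^sub>R w1" "B r *v w2 = t2 *\<^sub>R w2"
      unfolding w1_def w2_def block_part_direct_sum[OF p dsr, symmetric] Du
      by (simp_all add: block_part_def vec_eq_iff)

    have form: "(M s *v x) \<bullet> (A s *v (M s *v x')) = block_part p x \<bullet> (B s *v block_part p x')"
      if s: "s \<in> \<Omega>0" and x: "off_block_part p x = 0" for s x x'
    proof -
      have "(M s *v x) \<bullet> (A s *v (M s *v x')) = x \<bullet> (D s *v x')"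
        unfolding Dv by (metis dot_lmul_matrix vector_transpose_matrix)
      also have "\<dots> = block_part p x \<bullet> (B s *v block_part p x')"
        using inner_block_part[OF p x] block_part_direct_sum[OF p ds[OF s]] by simp
      finally show ?thesis .
    qed
    have frame: "(M r *v x) \<bullet> (DA r h *v (M r *v x'))
        = block_part p x \<bullet> (DB r h *v block_part p x') + (s - s') * ((DM r h *v x) \<bullet> (M r *v x'))"
      if "off_block_part p x = 0" "A r *v (M r *v x) = s *\<^sub>R (M r *v x)"
        "A r *v (M r *v x') = s' *\<^sub>R (M r *v x')" for x x' s s' h
      by (rule inner_derivative_moving_frame[OF \<Omega>0(1) r0 DA DM[OF r0] DB[OF r0] orth form[OF _ that(1)] symA that(2,3)])
    have step: "step_matrix A r v1 v2 *v h - gap_vector w1 w2 (DB r h)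
        = vector [0, 2 * (t1 - t2) * ((DM r h *v u1) \<bullet> v2)]" for h
      using frame[of u1 t1 u1 t1 h] frame[of u2 t2 u2 t2 h] frame[of u1 t1 u2 t2 h] off v(4,5)
      by (simp add: step_matrix_mult[OF DA] gap_vector_def Mu w1_def w2_def vec_eq_iff forall_2
          algebra_simps)

    \<comment> \<open>the eigenvalue gap is the length of the coordinate gap of \<open>B r\<close>, hence \<open>O(d)\<close>\<close>
    have "norm (B r - B \<alpha>) \<le> norm (B r - B \<alpha> - DB \<alpha> (r - \<alpha>)) + norm (DB \<alpha> (r - \<alpha>))"
      using norm_triangle_ineq[of "B r - B \<alpha> - DB \<alpha> (r - \<alpha>)" "DB \<alpha> (r - \<alpha>)"] by simp
    also have "\<dots> \<le> KB * d\<^sup>2 + KB0 * d"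
      using estB(1)[OF _ _ rB] KB0(2)[of "r - \<alpha>"] by (intro add_mono) (auto simp: d_def)
    also have "\<dots> \<le> KB * d + KB0 * d"
      using d e eB by (intro add_right_mono mult_left_mono) (auto simp: power2_eq_square mult_left_le)
    finally have Bd: "norm (B r - B \<alpha>) \<le> (KB0 + KB) * d" by (simp add: algebra_simps)
    have b: "gap_vector w1 w2 (B r) = vector [t1 - t2, 0]" by (rule gap_vector_eigenpair[OF w Bw])
    have "\<bar>t1 - t2\<bar> = norm (gap_vector w1 w2 (B r))" by (simp add: b norm_vector_2)
    also have "\<dots> = norm (coordinate_gap (B r - B \<alpha>))"
      by (simp add: norm_gap_vector_orthonormal[OF symBr w] linear_diff[OF linear_coordinate_gap] B\<alpha>(2))
    also have "\<dots> \<le> G * ((KB0 + KB) * d)"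
      using G(2)[of "B r - B \<alpha>"] mult_left_mono[OF Bd, of G] G(1) by linarith
    finally have t12: "\<bar>t1 - t2\<bar> \<le> G * ((KB0 + KB) * d)" .
    have DMr: "norm (DM r h) \<le> (KM0 + KM) * norm h" for h
    proof -
      have "norm (DM r h) \<le> norm (DM \<alpha> h) + norm (DM r h - DM \<alpha> h)"
        using norm_triangle_ineq[of "DM \<alpha> h" "DM r h - DM \<alpha> h"] by simp
      also have "\<dots> \<le> KM0 * norm h + KM * d * norm h"
        using KM0(2)[of h] lipM[OF rM, of h] by (simp add: d_def)
      also have "\<dots> \<le> KM0 * norm h + KM * 1 * norm h"
        using d e eM by (intro add_left_mono mult_right_mono mult_left_mono) auto
      finally show ?thesis by (simp add: algebra_simps)
    qed
    have err: "norm (step_matrix A r v1 v2 *v h - gap_vector w1 w2 (DB r h)) \<le> m * d * norm h" for h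
    proof -
      have "\<bar>(DM r h *v u1) \<bullet> v2\<bar> \<le> norm (DM r h *v u1) * norm v2"
        by (rule Cauchy_Schwarz_ineq2)
      also have "\<dots> \<le> (KM0 + KM) * norm h"
        using norm_matrix_vector_le[of "DM r h" u1] DMr[of h] by (simp add: u v)
      finally have "\<bar>t1 - t2\<bar> * \<bar>(DM r h *v u1) \<bullet> v2\<bar> \<le> G * ((KB0 + KB) * d) * ((KM0 + KM) * norm h)"
        using t12 by (intro mult_mono) auto
      moreover have "norm (step_matrix A r v1 v2 *v h - gap_vector w1 w2 (DB r h))
          = 2 * (\<bar>t1 - t2\<bar> * \<bar>(DM r h *v u1) \<bullet> v2\<bar>)"
        unfolding step norm_vector_2
        by (simp only: zero_power2 add_0_left real_sqrt_abs abs_mult abs_numeral mult.assoc)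
      moreover have "m * d * norm h = 2 * (G * ((KB0 + KB) * d) * ((KM0 + KM) * norm h))"
        by (simp only: m_def mult.assoc mult.left_commute mult.commute)
      ultimately show ?thesis by linarith
    qed

    have est: "(c - (G * KB + m) * d) * norm x \<le> norm (step_matrix A r v1 v2 *v x)"
      "norm (step_matrix A r v1 v2 *v (r - \<alpha>) - gap_vector w1 w2 (B r)) \<le> (G * (2 * KB) + m) * d\<^sup>2" for x
    proof -
      have rem: "norm (DB r (r - \<alpha>) - (B r - B \<alpha>)) \<le> 2 * KB * d\<^sup>2"
        unfolding d_def by (rule estB(2)[OF _ _ rB])
      have lip: "norm (DB r x - DB \<alpha> x) \<le> KB * d * norm x" for x
        unfolding d_def by (rule lipB[OF rB])
      note * = perturbed_coordinate_gap_estimates[OF G(2) less_imp_le[OF G(1)]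
          has_derivative_linear[OF DB[OF r0]] c(2)[unfolded DF_def] lip err
          has_derivative_symmetric[OF \<Omega>0(1) r0 DB[OF r0] symB] symBr symB[OF \<Omega>0(2)] w B\<alpha>(2) rem d_def[symmetric]]
      show "(c - (G * KB + m) * d) * norm x \<le> norm (step_matrix A r v1 v2 *v x)" by (rule *(1))
      show "norm (step_matrix A r v1 v2 *v (r - \<alpha>) - gap_vector w1 w2 (B r)) \<le> (G * (2 * KB) + m) * d\<^sup>2"
        by (rule *(2))
    qed
    have lower: "c / 2 * norm x \<le> norm (step_matrix A r v1 v2 *v x)" for x
    proof -
      have "(G * KB + m) * d \<le> C1 * d"
        using G eB d by (intro mult_right_mono) (auto simp: C1_def)
      also have "\<dots> \<le> C1 * (c / (2 * C1))" using d e C1 by (intro mult_left_mono) auto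
      also have "\<dots> = c / 2" using C1 by simp
      finally have "c / 2 * norm x \<le> (c - (G * KB + m) * d) * norm x"
        by (intro mult_right_mono) auto
      then show ?thesis using est(1)[of x] by linarith
    qed
    have res: "norm (step_matrix A r v1 v2 *v (r - \<alpha>) - vector [t1 - t2, 0]) \<le> C1 * d\<^sup>2"
      using est(2) by (simp only: b C1_def)
    show ?thesis
      using perturbed_newton_step[OF lower half_gt_zero[OF c(1)] res]
      by (simp add: next_iterate_def t1_def t2_def d_def mult_ac)
  qed
  show ?thesis
    by (intro exI[of _ "ball \<alpha> e"] exI[of _ "C1 / (c / 2)"]) (use main e(1) C1 c(1) in auto)
qed

end
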